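(* Let $\mathcal{T}$ be a $\Sigma_1$-theory. If $\mathcal{T}$ is smooth and has the finite model property, then its natural density $\mu(\mathcal{T})$ is well-defined and equal to $1$.
   Context: $\Sigma_1$ is the one-sorted first-order signature with no function or predicate symbols other than equality. Interpretations have non-empty domains and assign values to all variables; a theory is the class of all interpretations satisfying a given set of sentences. $\mathrm{Spec}(\mathcal{T})$ is the set of finite cardinalities of domains of $\mathcal{T}$-interpretations, $\mathrm{Spec}_n(\mathcal{T})=\mathrm{Spec}(\mathcal{T})\cap\{1,\dots,n\}$, and $\mu(\mathcal{T})=\lim_{n\to\infty}|\mathrm{Spec}_n(\mathcal{T})|/n$. $\mathcal{T}$ is smooth if for every quantifier-free formula $\phi$, every $\mathcal{T}$-interpretation $\mathcal{A}$ satisfying $\phi$, and every cardinal $\kappa>|\mathrm{dom}(\mathcal{A})|$, there is a $\mathcal{T}$-interpretation satisfying $\phi$ with domain of cardinality $\kappa$. $\mathcal{T}$ has the finite model property if every $\mathcal{T}$-satisfiable quantifier-free formula is satisfied by a $\mathcal{T}$-interpretation with finite domain.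
   Formalization: The theory is assumed to be consistent (to have at least one interpretation); the inconsistent theory is vacuously smooth with the finite model property, but its spectrum is empty and its density is 0. Domains are taken inside an arbitrary infinite universe. *)

theory Defs
  imports Complex_Main
begin

unbundle cardinal_syntax

text \<open>The only terms of the signature are variables, which are identified with natural numbers.\<close>

datatype fm =
    Eq nat nat
  | Neg fm
  | Conj fm fm
  | Disj fm fm
  | Impl fm fm
  | Forall nat fm
  | Exists nat fm

primrec free_vars :: "fm \<Rightarrow> nat set" where
  "free_vars (Eq x y) = {x, y}"
| "free_vars (Neg \<phi>) = free_vars \<phi>"
| "free_vars (Conj \<phi> \<psi>) = free_vars \<phi> \<union> free_vars \<psi>"
| "free_vars (Disj \<phi> \<psi>) = free_vars \<phi> \<union> free_vars \<psi>"
| "free_vars (Impl \<phi> \<psi>) = free_vars \<phi> \<union> free_vars \<psi>"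
| "free_vars (Forall x \<phi>) = free_vars \<phi> - {x}"
| "free_vars (Exists x \<phi>) = free_vars \<phi> - {x}"

definition sentence :: "fm \<Rightarrow> bool" where
  "sentence \<phi> \<longleftrightarrow> free_vars \<phi> = {}"

primrec quantifier_free :: "fm \<Rightarrow> bool" where
  "quantifier_free (Eq x y) = True"
| "quantifier_free (Neg \<phi>) = quantifier_free \<phi>"
| "quantifier_free (Conj \<phi> \<psi>) = (quantifier_free \<phi> \<and> quantifier_free \<psi>)"
| "quantifier_free (Disj \<phi> \<psi>) = (quantifier_free \<phi> \<and> quantifier_free \<psi>)"
| "quantifier_free (Impl \<phi> \<psi>) = (quantifier_free \<phi> \<and> quantifier_free \<psi>)"
| "quantifier_free (Forall x \<phi>) = False"
| "quantifier_free (Exists x \<phi>) = False"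

text \<open>The type \<open>'a\<close> is the universe from which domains are drawn. HOL cannot quantify over all
  domains (or all cardinals) inside a formula, so every notion below is relative to \<open>'a\<close>, which is
  left arbitrary; a type \<open>'a\<close> with infinitely many elements accommodates every finite domain.\<close>

record 'a interp =
  domain :: "'a set"
  assign :: "nat \<Rightarrow> 'a"

definition is_interp :: "'a interp \<Rightarrow> bool" where
  "is_interp A \<longleftrightarrow> domain A \<noteq> {} \<and> (\<forall>x. assign A x \<in> domain A)"

primrec holds :: "'a set \<Rightarrow> (nat \<Rightarrow> 'a) \<Rightarrow> fm \<Rightarrow> bool" where
  "holds D v (Eq x y) \<longleftrightarrow> v x = v y"
| "holds D v (Neg \<phi>) \<longleftrightarrow> \<not> holds D v \<phi>"
| "holds D v (Conj \<phi> \<psi>) \<longleftrightarrow> holds D v \<phi> \<and> holds D v \<psi>"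
| "holds D v (Disj \<phi> \<psi>) \<longleftrightarrow> holds D v \<phi> \<or> holds D v \<psi>"
| "holds D v (Impl \<phi> \<psi>) \<longleftrightarrow> (holds D v \<phi> \<longrightarrow> holds D v \<psi>)"
| "holds D v (Forall x \<phi>) \<longleftrightarrow> (\<forall>d\<in>D. holds D (v(x := d)) \<phi>)"
| "holds D v (Exists x \<phi>) \<longleftrightarrow> (\<exists>d\<in>D. holds D (v(x := d)) \<phi>)"

definition satisfies :: "'a interp \<Rightarrow> fm \<Rightarrow> bool" (infix \<open>\<Turnstile>\<close> 50) where
  "A \<Turnstile> \<phi> \<longleftrightarrow> holds (domain A) (assign A) \<phi>"

definition is_theory :: "'a interp set \<Rightarrow> bool" where
  "is_theory T \<longleftrightarrow>
    (\<exists>Ax. (\<forall>\<phi>\<in>Ax. sentence \<phi>) \<and> T = {A. is_interp A \<and> (\<forall>\<phi>\<in>Ax. A \<Turnstile> \<phi>)})"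

text \<open>A relation \<open>\<kappa> :: 'a rel\<close> with \<open>Card_order \<kappa>\<close> ranges over all cardinals, finite and infinite,
  up to the cardinality of the universe \<open>'a\<close>.\<close>

definition smooth :: "'a interp set \<Rightarrow> bool" where
  "smooth T \<longleftrightarrow>
    (\<forall>\<phi> A (\<kappa> :: 'a rel).
      quantifier_free \<phi> \<longrightarrow> A \<in> T \<longrightarrow> A \<Turnstile> \<phi> \<longrightarrow> Card_order \<kappa> \<longrightarrow> |domain A| <o \<kappa> \<longrightarrow>
      (\<exists>B\<in>T. B \<Turnstile> \<phi> \<and> |domain B| =o \<kappa>))"

definition finite_model_property :: "'a interp set \<Rightarrow> bool" where
  "finite_model_property T \<longleftrightarrow>
    (\<forall>\<phi>. quantifier_free \<phi> \<longrightarrow> (\<exists>A\<in>T. A \<Turnstile> \<phi>) \<longrightarrow> (\<exists>B\<in>T. B \<Turnstile> \<phi> \<and> finite (domain B)))"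

definition Spec :: "'a interp set \<Rightarrow> nat set" where
  "Spec T = {card (domain A) | A. A \<in> T \<and> finite (domain A)}"

definition Spec_upto :: "'a interp set \<Rightarrow> nat \<Rightarrow> nat set" where
  "Spec_upto T n = Spec T \<inter> {1..n}"

definition spec_ratio :: "'a interp set \<Rightarrow> nat \<Rightarrow> real" where
  "spec_ratio T n = real (card (Spec_upto T n)) / real n"

definition natural_density :: "'a interp set \<Rightarrow> real" where
  "natural_density T = lim (spec_ratio T)"

end

theory Submission
  imports Defs
begin

text \<open>On a tautology, the finite model property only says that a nonempty theory has some
  finite model, say of size \<open>m\<close>. Smoothness on the same tautology then yields models of
  every finite size above \<open>m\<close> (\<open>smooth_Spec_upward\<close>). So the spectrum is
  cofinite, and a cofinite set of naturals has density 1
  (\<open>spec_ratio_tendsto_1\<close>).\<close>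

lemma smooth_Spec_upward:
  fixes T :: "'a interp set"
  assumes inf: "infinite (UNIV :: 'a set)" and sm: "smooth T"
    and m: "m \<in> Spec T" and "m < n"
  shows "n \<in> Spec T"
proof -
  obtain A where A: "A \<in> T" "finite (domain A)" "card (domain A) = m"
    using m unfolding Spec_def by auto
  \<comment> \<open>The infinite universe supplies a set of each finite size; \<open>|S|\<close>
    serves as the cardinal \<kappa> in smoothness.\<close>
  obtain S :: "'a set" where S: "finite S" "card S = n"
    using infinite_arbitrarily_large[OF inf] by blast
  have "|domain A| <o |S|"
  proof -
    have "\<not> |S| \<le>o |domain A|"
    proof
      assume "|S| \<le>o |domain A|"
      then have "card S \<le> card (domain A)"
        using A(2) card_inj_on_le by (metis card_of_ordLeq)
      then show False
        using A S \<open>m < n\<close> by simp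
    qed
    then show ?thesis
      by (simp add: not_ordLeq_iff_ordLess card_of_Well_order)
  qed
  \<comment> \<open>A tautology leaves only the condition on size.\<close>
  moreover have "quantifier_free (Eq 0 0)" "A \<Turnstile> Eq 0 0"
    by (simp_all add: satisfies_def)
  ultimately obtain B where B: "B \<in> T" "|domain B| =o |S|"
    using sm A(1) card_of_Card_order[of S] unfolding smooth_def by blast
  then obtain f where "bij_betw f (domain B) S"
    using card_of_ordIso by blast
  then have "finite (domain B)" "card (domain B) = n"
    using S by (auto simp: bij_betw_finite bij_betw_same_card)
  then show ?thesis
    using B(1) unfolding Spec_def by blast
qed

text \<open>At most \<open>m\<close> elements of \<open>{1..n}\<close> are missing, which squeezes
  the ratio between \<open>1 - m/n\<close> and 1.\<close>

lemma spec_ratio_tendsto_1: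
  assumes cofinite: "\<And>n. m < n \<Longrightarrow> n \<in> Spec T"
  shows "spec_ratio T \<longlonglongrightarrow> 1"
proof (rule tendsto_sandwich)
  \<comment> \<open>At \<open>n = 0\<close> the bound fails: division by zero gives 0, so it would
    read \<open>1 \<le> 0\<close>.\<close>
  have "1 - real m / real n \<le> spec_ratio T n" if "n > 0" for n
  proof -
    have "{m<..n} \<subseteq> Spec_upto T n"
      using cofinite unfolding Spec_upto_def by auto
    then have "card {m<..n} \<le> card (Spec_upto T n)"
      by (intro card_mono) (auto simp: Spec_upto_def)
    then have "(real n - real m) / real n \<le> spec_ratio T n"
      unfolding spec_ratio_def by (intro divide_right_mono) auto
    then show ?thesis
      using that by (simp add: diff_divide_distrib)
  qed
  then show "\<forall>\<^sub>F n in sequentially. 1 - real m / real n \<le> spec_ratio T n"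
    by (rule eventually_mono[OF eventually_gt_at_top])
  have "spec_ratio T n \<le> 1" for n
  proof -
    have "card (Spec_upto T n) \<le> card {1..n}"
      by (intro card_mono) (auto simp: Spec_upto_def)
    then show ?thesis
      by (auto simp: spec_ratio_def divide_le_eq_1)
  qed
  then show "\<forall>\<^sub>F n in sequentially. spec_ratio T n \<le> 1"
    by simp
  show "(\<lambda>n. 1 - real m / real n) \<longlonglongrightarrow> 1"
    using tendsto_diff[OF tendsto_const lim_const_over_n[of "real m"], of 1] by simp
qed simp

text \<open>\<open>lim\<close> is total, so well-definedness is the separate claim
  \<open>convergent\<close>. The inconsistent theory must be excluded: it satisfies both properties
  vacuously, yet its spectrum is empty and its density 0.\<close>

theorem theorem3:
  fixes T :: "'a interp set"
  assumes "infinite (UNIV :: 'a set)"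
    and "is_theory T"
    and "T \<noteq> {}"
    and "smooth T"
    and "finite_model_property T"
  shows "convergent (spec_ratio T) \<and> natural_density T = 1"
proof -
  have "quantifier_free (Eq 0 0)" "\<exists>A\<in>T. A \<Turnstile> Eq 0 0"
    using assms(3) by (auto simp: satisfies_def)
  then obtain A where "A \<in> T" "finite (domain A)"
    using assms(5) unfolding finite_model_property_def by blast
  then have "card (domain A) \<in> Spec T"
    unfolding Spec_def by blast
  then have "spec_ratio T \<longlonglongrightarrow> 1"
    using spec_ratio_tendsto_1 smooth_Spec_upward[OF assms(1,4)] by blast
  then show ?thesis
    unfolding natural_density_def using convergentI limI by blast
qed

end
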